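(* Let $1\le p\le n$, $\lambda>0$, and let $f:\mathbb{R}^{n\times p}\to\mathbb{R}$ be continuously differentiable with locally Lipschitz continuous gradient $\nabla f$. For every $X_0\in\mathbb{R}^{n\times p}$ of full column rank, let $t\mapsto\varphi_t(X_0)$, $t\ge 0$, be the solution of the landing system $\dot X(t)=-\Lambda(X(t))$ with $X(0)=X_0$. Then every $\omega$-limit point of $\varphi_t(X_0)$ belongs to the set $\mathcal{C}$ of critical points of $f$ relative to the Stiefel manifold $\mathrm{St}(p,n)$; in other words, $\varphi_t(X_0)$ converges to the set $\mathcal{C}$ as $t\to\infty$.
   Context: Notation: $\mathrm{skew}(A)=\frac12(A-A^\top)$ for square $A$; $\|\cdot\|_{\mathrm F}$ is the Frobenius norm; $\nabla$ denotes the Euclidean gradient with respect to the Frobenius inner product. The Stiefel manifold is $\mathrm{St}(p,n)=\{X\in\mathbb{R}^{n\times p}:X^\top X=I_p\}$. The landing field $\Lambda:\mathbb{R}^{n\times p}\to\mathbb{R}^{n\times p}$ is $$\Lambda(X)=\psi(X)X+\lambda\nabla\mathcal{N}(X),\quad \psi(X)=2\,\mathrm{skew}(\nabla f(X)X^\top),\quad \mathcal{N}(X)=\tfrac14\|X^\top X-I_p\|_{\mathrm F}^2,$$ so that $\nabla\mathcal{N}(X)=X(X^\top X-I_p)$. For $X_0$ of full column rank, the landing system $\dot X(t)=-\Lambda(X(t))$, $X(0)=X_0$, has a unique solution $\varphi_t(X_0)$ defined for all $t\ge0$. The set of critical points of $f$ relative to $\mathrm{St}(p,n)$ is $\mathcal{C}=\{X^*\in\mathrm{St}(p,n):\psi(X^*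 )X^*=0\}$. An $\omega$-limit point of a trajectory $\varphi_t$ is a point $\varphi^*$ for which there is a sequence $t_k\to\infty$ with $\varphi_{t_k}\to\varphi^*$. Convergence of a trajectory to a set means that its distance to the set tends to $0$ as $t\to\infty$. *)

theory Defs
  imports "HOL-Analysis.Analysis"
begin

text \<open>
  Matrices in \<open>\<real>\<^bsup>n \<times> p\<^esup>\<close> are represented by the type \<^typ>\<open>real ^ 'p ^ 'n\<close> with
  \<open>n = CARD('n)\<close> and \<open>p = CARD('p)\<close>. The Euclidean norm and inner product that the library
  puts on this type are the Frobenius norm and the Frobenius inner product.
\<close>

text \<open>The value is meaningful only where the function is differentiable.\<close>

definition gradient :: "('a::real_inner \<Rightarrow> real) \<Rightarrow> 'a \<Rightarrow> 'a" where
  "gradient f x = (THE D. GDERIV f x :> D)"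

lemma gradient_eqI:
  assumes "GDERIV f x :> D"
  shows "gradient f x = D"
  unfolding gradient_def
proof (rule the_equality)
  fix E assume "GDERIV f x :> E"
  then have "(\<lambda>h. h \<bullet> E) = (\<lambda>h. h \<bullet> D)"
    using assms unfolding gderiv_def by (rule has_derivative_unique)
  then have "(E - D) \<bullet> E = (E - D) \<bullet> D"
    by metis
  then have "(E - D) \<bullet> (E - D) = 0"
    by (simp add: inner_diff_right)
  then show "E = D"
    by simp
qed (fact assms)

lemma GDERIV_gradient:
  fixes f :: "'a::euclidean_space \<Rightarrow> real"
  assumes "f differentiable (at x)"
  shows "GDERIV f x :> gradient f x"
proof -
  obtain f' where f': "(f has_derivative f') (at x)"
    using assms by (auto simp: differentiable_def)
  then have lin: "linear f'"
    by (rule has_derivative_linear)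
  have "f' = (\<lambda>h. h \<bullet> adjoint f' 1)"
    using adjoint_works[OF lin, of _ 1] by (auto simp: fun_eq_iff)
  with f' have "GDERIV f x :> adjoint f' 1"
    unfolding gderiv_def by simp
  then show ?thesis
    using gradient_eqI by metis
qed

definition skew :: "real ^ 'n ^ 'n \<Rightarrow> real ^ 'n ^ 'n" where
  "skew A = (1 / 2) *\<^sub>R (A - transpose A)"

definition Stiefel :: "(real ^ 'p ^ 'n) set" where
  "Stiefel = {X. transpose X ** X = mat 1}"

definition landing_psi :: "(real ^ 'p ^ 'n \<Rightarrow> real) \<Rightarrow> real ^ 'p ^ 'n \<Rightarrow> real ^ 'n ^ 'n" where
  "landing_psi f X = 2 *\<^sub>R skew (gradient f X ** transpose X)"

definition landing_penalty :: "real ^ 'p ^ 'n \<Rightarrow> real" where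
  "landing_penalty X = (1 / 4) * (norm (transpose X ** X - mat 1))\<^sup>2"

definition landing_field ::
    "real \<Rightarrow> (real ^ 'p ^ 'n \<Rightarrow> real) \<Rightarrow> real ^ 'p ^ 'n \<Rightarrow> real ^ 'p ^ 'n" where
  "landing_field lam f X = landing_psi f X ** X + lam *\<^sub>R gradient landing_penalty X"

definition landing_solution ::
    "real \<Rightarrow> (real ^ 'p ^ 'n \<Rightarrow> real) \<Rightarrow> real ^ 'p ^ 'n \<Rightarrow> (real \<Rightarrow> real ^ 'p ^ 'n) \<Rightarrow> bool" where
  "landing_solution lam f X\<^sub>0 \<phi> \<longleftrightarrow>
     \<phi> 0 = X\<^sub>0 \<and>
     (\<forall>t\<ge>0. (\<phi> has_vector_derivative - landing_field lam f (\<phi> t)) (at t within {0..}))"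

definition Stiefel_critical_points :: "(real ^ 'p ^ 'n \<Rightarrow> real) \<Rightarrow> (real ^ 'p ^ 'n) set" where
  "Stiefel_critical_points f = {X \<in> Stiefel. landing_psi f X ** X = 0}"

definition omega_limit_point :: "(real \<Rightarrow> 'a::topological_space) \<Rightarrow> 'a \<Rightarrow> bool" where
  "omega_limit_point \<phi> x \<longleftrightarrow>
     (\<exists>s :: nat \<Rightarrow> real. (\<forall>k. s k \<ge> 0) \<and> filterlim s at_top sequentially \<and>
        (\<lambda>k. \<phi> (s k)) \<longlonglongrightarrow> x)"

text \<open>
  Nonemptiness is required because \<^const>\<open>infdist\<close> is 0 for the empty set.
\<close>

definition converges_to_set :: "(real \<Rightarrow> 'a::metric_space) \<Rightarrow> 'a set \<Rightarrow> bool" where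
  "converges_to_set \<phi> S \<longleftrightarrow> S \<noteq> {} \<and> ((\<lambda>t. infdist (\<phi> t) S) \<longlongrightarrow> 0) at_top"

end

theory Submission
  imports Defs "HOL-Real_Asymp.Real_Asymp"
begin

text \<open>
  The Gram matrix \<open>G = X\<^sup>T X\<close> of a trajectory satisfies the closed equation \<open>G' = -2\<lambda> G (G - I)\<close>,
  because the skew part of the field drops out. If \<open>H = G(0)\<inverse>\<close>, then
  \<open>G(t) (I + exp (-2\<lambda>t) (H - I)) = I\<close>, so \<open>G\<close> tends to \<open>I\<close> exponentially fast. Along the
  trajectory, \<open>f\<close> decreases at rate \<open>\<parallel>\<psi>\<parallel>\<^sup>2/2\<close> up to an exponentially small error; since \<open>f\<close> is
  bounded below on the bounded trajectory and \<open>\<psi>\<close> is uniformly continuous along it, Barbalat's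
  argument gives \<open>\<psi> \<rightarrow> 0\<close>. Both \<open>G = I\<close> and \<open>\<psi> = 0\<close> pass to \<open>\<omega>\<close>-limit points.
\<close>

section \<open>Matrix calculus with the Frobenius inner product\<close>

lemma bounded_bilinear_matrix_mult:
  "bounded_bilinear (\<lambda>(A :: real ^ 'n ^ 'm) (B :: real ^ 'p ^ 'n). A ** B)"
  unfolding bilinear_conv_bounded_bilinear[symmetric] bilinear_def
  by (auto intro!: linearI simp: matrix_matrix_mult_def vec_eq_iff distrib_left distrib_right
      sum.distrib sum_distrib_left mult_ac)

lemmas matrix_mult_add_distrib = bounded_bilinear.add_left[OF bounded_bilinear_matrix_mult]
  bounded_bilinear.add_right[OF bounded_bilinear_matrix_mult]

lemmas matrix_mult_diff_distrib = bounded_bilinear.diff_left[OF bounded_bilinear_matrix_mult]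
  bounded_bilinear.diff_right[OF bounded_bilinear_matrix_mult]

lemmas matrix_mult_minus = bounded_bilinear.minus_left[OF bounded_bilinear_matrix_mult]
  bounded_bilinear.minus_right[OF bounded_bilinear_matrix_mult]

lemmas matrix_mult_scaleR = bounded_bilinear.scaleR_left[OF bounded_bilinear_matrix_mult]
  bounded_bilinear.scaleR_right[OF bounded_bilinear_matrix_mult]

lemmas continuous_on_matrix_mult [continuous_intros] =
  bounded_bilinear.continuous_on[OF bounded_bilinear_matrix_mult]

lemma bounded_linear_transpose:
  "bounded_linear (transpose :: real ^ 'n ^ 'm \<Rightarrow> real ^ 'm ^ 'n)"
  unfolding linear_conv_bounded_linear[symmetric]
  by (auto intro!: linearI simp: transpose_def vec_eq_iff)

lemmas transpose_diff = linear_diff[OF bounded_linear.linear[OF bounded_linear_transpose]]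
lemmas transpose_minus = linear_neg[OF bounded_linear.linear[OF bounded_linear_transpose]]
lemmas transpose_add = linear_add[OF bounded_linear.linear[OF bounded_linear_transpose]]
lemmas continuous_on_transpose [continuous_intros] =
  bounded_linear.continuous_on[OF bounded_linear_transpose]

lemma inner_transpose:
  fixes A B :: "real ^ 'n ^ 'm"
  shows "transpose A \<bullet> transpose B = A \<bullet> B"
  unfolding inner_vec_def transpose_def by (simp add: sum.swap[of _ "UNIV :: 'n set"])

lemma inner_matrix_mult_right:
  fixes A :: "real ^ 'n ^ 'm" and B :: "real ^ 'p ^ 'n"
  shows "(A ** B) \<bullet> C = A \<bullet> (C ** transpose B)"
proof -
  have "(\<Sum>j\<in>UNIV. \<Sum>k\<in>UNIV. A $ i $ k * B $ k $ j * C $ i $ j) =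
        (\<Sum>k\<in>UNIV. \<Sum>j\<in>UNIV. A $ i $ k * (C $ i $ j * B $ k $ j))" for i
    by (subst sum.swap) (simp add: mult_ac)
  then show ?thesis
    by (simp add: inner_vec_def matrix_matrix_mult_def transpose_def sum_distrib_left sum_distrib_right)
qed

text \<open>Transposition preserves the inner product and swaps the order of factors, so this
  reduces to \<open>inner_matrix_mult_right\<close>.\<close>

lemma inner_matrix_mult_left:
  fixes A :: "real ^ 'n ^ 'm" and B :: "real ^ 'p ^ 'n"
  shows "(A ** B) \<bullet> C = B \<bullet> (transpose A ** C)"
proof -
  have "(A ** B) \<bullet> C = (transpose B ** transpose A) \<bullet> transpose C"
    by (metis inner_transpose matrix_transpose_mul)
  also have "\<dots> = transpose B \<bullet> (transpose C ** A)"
    by (simp add: inner_matrix_mult_right)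
  also have "\<dots> = B \<bullet> (transpose A ** C)"
    by (metis inner_transpose matrix_transpose_mul transpose_transpose)
  finally show ?thesis .
qed

text \<open>Positive semidefiniteness of the Gram matrix, in the form that makes the norm of a
  solution of \<open>D' = - c G D\<close> with \<open>c > 0\<close> nonincreasing.\<close>

lemma inner_gram_mult:
  fixes X :: "real ^ 'p ^ 'n" and D :: "real ^ 'q ^ 'p"
  shows "D \<bullet> (transpose X ** X ** D) = (norm (X ** D))\<^sup>2"
  by (metis inner_matrix_mult_left matrix_mul_assoc power2_norm_eq_inner)

section \<open>Algebra of the landing field\<close>

lemma gradient_landing_penalty:
  fixes X :: "real ^ 'p ^ 'n"
  shows "gradient landing_penalty X = X ** (transpose X ** X - mat 1)"
proof (rule gradient_eqI)
  define S where "S = transpose X ** X - mat 1"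
  have tS: "transpose S = S"
    by (simp add: S_def transpose_diff matrix_transpose_mul)
  have eq: "landing_penalty = (\<lambda>X :: real ^ 'p ^ 'n.
      (1/4) * ((transpose X ** X - mat 1) \<bullet> (transpose X ** X - mat 1)))"
    by (simp add: landing_penalty_def power2_norm_eq_inner fun_eq_iff)
  have d: "((\<lambda>X. transpose X ** X - mat 1) has_derivative
      (\<lambda>h. transpose X ** h + transpose h ** X)) (at X)"
    by (auto intro!: derivative_eq_intros
        bounded_bilinear.FDERIV[OF bounded_bilinear_matrix_mult]
        bounded_linear.has_derivative[OF bounded_linear_transpose])
  \<comment> \<open>Since \<open>S\<close> is symmetric, \<open>transpose X ** h\<close> and its
    transpose have the same product with \<open>S\<close>; the four equal terms cancel the factor
    1/4.\<close>
  have *: "h \<bullet> (X ** S) = (1/4) * (S \<bullet> (transpose X ** h + transpose h ** X) +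
      (transpose X ** h + transpose h ** X) \<bullet> S)" for h
  proof -
    have "(transpose X ** h) \<bullet> S = h \<bullet> (X ** S)"
      by (simp add: inner_matrix_mult_left)
    moreover have "(transpose h ** X) \<bullet> S = (transpose X ** h) \<bullet> S"
      by (metis inner_transpose matrix_transpose_mul tS transpose_transpose)
    ultimately show ?thesis
      by (simp add: inner_add_left inner_add_right inner_commute[of S])
  qed
  show "GDERIV landing_penalty X :> X ** (transpose X ** X - mat 1)"
    unfolding gderiv_def eq S_def[symmetric] *
    unfolding S_def
    by (rule has_derivative_mult_right[OF has_derivative_inner[OF d d]])
qed

lemma transpose_landing_psi: "transpose (landing_psi f X) = - landing_psi f X"
  by (simp add: landing_psi_def skew_def transpose_scalar transpose_diff)

text \<open>Moving \<open>X\<close> to the other factor pairs \<open>P = A - transpose A\<close>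
  with \<open>A\<close>. A skew matrix is orthogonal to the symmetric part of \<open>A\<close>, and
  the skew part of \<open>A\<close> is \<open>P / 2\<close>. This is the dissipation term in the
  derivative of \<open>f\<close> along a trajectory.\<close>

lemma inner_landing_psi_gradient:
  fixes X :: "real ^ 'p ^ 'n"
  shows "(landing_psi f X ** X) \<bullet> gradient f X = (norm (landing_psi f X))\<^sup>2 / 2"
proof -
  define A where "A = gradient f X ** transpose X"
  define P where "P = landing_psi f X"
  have P: "P = A - transpose A"
    by (simp add: P_def A_def landing_psi_def skew_def)
  have "P \<bullet> transpose A = transpose P \<bullet> A"
    by (metis inner_transpose transpose_transpose)
  then have "P \<bullet> transpose A = - (P \<bullet> A)"
    by (simp add: P_def transpose_landing_psi)
  then have "P \<bullet> P = 2 * (P \<bullet> A)"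
    by (subst (2) P) (simp add: inner_diff_right)
  then show ?thesis
    by (simp add: inner_matrix_mult_right power2_norm_eq_inner P_def A_def)
qed

lemma landing_field_eq:
  "landing_field lam f X = landing_psi f X ** X + lam *\<^sub>R (X ** (transpose X ** X - mat 1))"
  by (simp add: landing_field_def gradient_landing_penalty)

text \<open>As \<open>P\<close> is skew, \<open>transpose X ** P ** X\<close> enters the two
  summands with opposite signs. The penalty term enters twice with the same value because
  \<open>G\<close> is symmetric and commutes with \<open>G - mat 1\<close>.\<close>

lemma landing_field_gram:
  fixes X :: "real ^ 'p ^ 'n"
  defines "G \<equiv> transpose X ** X"
  shows "transpose X ** landing_field lam f X + transpose (landing_field lam f X) ** X =
    (2 * lam) *\<^sub>R (G ** (G - mat 1))"
proof -
  define P where "P = landing_psi f X"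
  have tP: "transpose P = - P"
    by (simp add: P_def transpose_landing_psi)
  have tG: "transpose G = G"
    by (simp add: G_def matrix_transpose_mul)
  have 1: "transpose X ** landing_field lam f X =
      transpose X ** P ** X + lam *\<^sub>R (G ** (G - mat 1))"
    by (simp add: landing_field_eq P_def G_def matrix_mult_add_distrib matrix_mult_scaleR matrix_mul_assoc)
  have 2: "transpose (landing_field lam f X) ** X =
      - (transpose X ** P ** X) + lam *\<^sub>R (G ** (G - mat 1))"
    by (simp add: landing_field_eq flip: P_def G_def)
      (simp add: transpose_add transpose_scalar transpose_diff matrix_transpose_mul tP tG
        matrix_mult_add_distrib matrix_mult_scaleR matrix_mult_minus matrix_mult_diff_distrib
        flip: matrix_mul_assoc G_def)
  show ?thesis
    unfolding 1 2 mult_2 scaleR_add_left by simp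
qed

section \<open>Comparison on the half-line, Barbalat's argument and convergence to a set\<close>

lemma has_real_derivative_le_imp_diff_le:
  fixes h :: "real \<Rightarrow> real"
  assumes "\<And>t. t \<ge> 0 \<Longrightarrow> (h has_real_derivative h' t) (at t within {0..})"
    and "0 \<le> s" "s \<le> t" "\<And>x. s \<le> x \<Longrightarrow> x \<le> t \<Longrightarrow> h' x \<le> c"
  shows "h t - h s \<le> c * (t - s)"
proof -
  have "\<exists>x\<in>{s..t}. h t - h s = h' x * (t - s)"
    using assms(2,3)
    by (intro mvt_very_simple)
      (auto simp flip: has_field_derivative_def intro!: DERIV_subset[OF assms(1)])
  then show ?thesis
    using assms(3,4) by (auto intro!: mult_right_mono)
qed

text \<open>The squared norm has derivative \<open>2 * (v t \<bullet> v' t)\<close>, hence never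
  exceeds its initial value.\<close>

lemma norm_le_initial:
  fixes v :: "real \<Rightarrow> 'a::real_inner"
  assumes "\<And>t. t \<ge> 0 \<Longrightarrow> (v has_vector_derivative v' t) (at t within {0..})"
    and "\<And>t. t \<ge> 0 \<Longrightarrow> v t \<bullet> v' t \<le> 0" and "0 \<le> t"
  shows "norm (v t) \<le> norm (v 0)"
proof -
  have "((\<lambda>t. v t \<bullet> v t) has_real_derivative 2 * (v t \<bullet> v' t)) (at t within {0..})" if "t \<ge> 0" for t
    using has_derivative_inner[OF assms(1)[OF that, unfolded has_vector_derivative_def]
        assms(1)[OF that, unfolded has_vector_derivative_def]]
    unfolding has_field_derivative_def
    by (rule has_derivative_eq_rhs) (simp add: fun_eq_iff inner_commute)
  from has_real_derivative_le_imp_diff_le[OF this, of 0 t 0]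
  have "v t \<bullet> v t \<le> v 0 \<bullet> v 0"
    using assms(2,3) by simp
  then show ?thesis
    by (simp add: norm_eq_sqrt_inner)
qed

text \<open>If \<open>w\<close> is at least \<open>e\<close> at some time, uniform continuity keeps
  it above \<open>e / 2\<close> for a fixed duration \<open>r\<close>, during which \<open>h\<close>
  falls by at least \<open>r * e / 2\<close>. That is impossible once \<open>h\<close> is closer
  than this to its infimum.\<close>

lemma Barbalat:
  fixes h w :: "real \<Rightarrow> real"
  assumes der: "\<And>t. t \<ge> 0 \<Longrightarrow> (h has_real_derivative h' t) (at t within {0..})"
    and le: "\<And>t. t \<ge> 0 \<Longrightarrow> h' t \<le> - w t"
    and nonneg: "\<And>t. t \<ge> 0 \<Longrightarrow> w t \<ge> 0"
    and bdd: "\<And>t. t \<ge> 0 \<Longrightarrow> m \<le> h t"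
    and uc: "uniformly_continuous_on {0..} w"
  shows "(w \<longlongrightarrow> 0) at_top"
proof (rule tendstoI)
  fix e :: real assume e: "e > 0"
  obtain d where d: "d > 0"
    "\<And>s t. s \<ge> 0 \<Longrightarrow> t \<ge> 0 \<Longrightarrow> dist t s < d \<Longrightarrow> dist (w t) (w s) < e / 2"
    using uc e unfolding uniformly_continuous_on_def
    by (metis atLeast_iff half_gt_zero)
  \<comment> \<open>Halving keeps the whole closed interval from \<open>t\<close> to
    \<open>t + r\<close> at distance strictly below \<open>d\<close> from \<open>t\<close>.\<close>
  define r where "r = d / 2"
  have r: "r > 0" "r < d"
    using d(1) by (auto simp: r_def)
  have anti: "h t \<le> h s" if "0 \<le> s" "s \<le> t" for s t
  proof -
    have "h' x \<le> 0" if "s \<le> x" for x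
      using le[of x] nonneg[of x] that \<open>0 \<le> s\<close> by linarith
    with has_real_derivative_le_imp_diff_le[OF der that, of 0] show ?thesis
      by simp
  qed
  define L where "L = Inf (h ` {0..})"
  have bb: "bdd_below (h ` {0..})"
    using bdd by (auto intro!: bdd_belowI)
  have "L < L + r * e / 2"
    using e r by simp
  then obtain T where T: "T \<ge> 0" "h T < L + r * e / 2"
    unfolding L_def using cInf_lessD[of "h ` {0..}"] by force
  have "dist (w t) 0 < e" if t: "t \<ge> T" for t
  proof (rule ccontr)
    assume "\<not> dist (w t) 0 < e"
    then have wt: "w t \<ge> e"
      using nonneg[of t] t T by (auto simp: dist_real_def)
    have "h' x \<le> - (e / 2)" if "t \<le> x" "x \<le> t + r" for x
    proof -
      have "dist (w x) (w t) < e / 2"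
        using that r t T by (intro d(2)) (auto simp: dist_real_def)
      then show ?thesis
        using le[of x] wt that t T unfolding dist_real_def by linarith
    qed
    then have "h (t + r) - h t \<le> - (e / 2) * r"
      using has_real_derivative_le_imp_diff_le[OF der, of t "t + r" "- (e / 2)"] t T r by simp
    moreover have "h t \<le> h T"
      using anti t T by simp
    moreover have "L \<le> h (t + r)"
      unfolding L_def using bb t T r by (auto intro!: cInf_lower)
    ultimately show False
      using T by (simp add: algebra_simps)
  qed
  then show "\<forall>\<^sub>F t in at_top. dist (w t) 0 < e"
    by (auto simp: eventually_at_top_linorder)
qed

text \<open>Times tending to infinity at which the distance to \<open>S\<close> stays at least
  \<open>e\<close> would, by compactness, yield a limit point outside \<open>S\<close>.\<close>

lemma converges_to_setI:
  fixes \<phi> :: "real \<Rightarrow> 'a::heine_borel"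
  assumes bdd: "bounded (\<phi> ` {0..})" and lim: "\<And>x. omega_limit_point \<phi> x \<Longrightarrow> x \<in> S"
  shows "converges_to_set \<phi> S"
proof -
  \<comment> \<open>The bound \<open>s k \<ge> real k\<close> forces the times to infinity. Applied
    to \<open>real\<close>, this shows that \<open>S\<close> is nonempty; applied to times of large
    distance, it gives the contradiction.\<close>
  have sub: "\<exists>l r. strict_mono r \<and> l \<in> S \<and> (\<lambda>k. \<phi> (s (r k))) \<longlonglongrightarrow> l"
    if s: "\<And>k. s k \<ge> real k" for s :: "nat \<Rightarrow> real"
  proof -
    have s0: "s k \<ge> 0" for k
      using s[of k] by linarith
    then have "bounded (range (\<lambda>k. \<phi> (s k)))"
      by (auto intro: bounded_subset[OF bdd])
    then obtain l r where lr: "strict_mono r" "((\<lambda>k. \<phi> (s k)) \<circ> r) \<longlonglongrightarrow> l"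
      using bounded_imp_convergent_subsequence by blast
    have "filterlim s at_top sequentially"
      using s by (intro filterlim_at_top_mono[OF filterlim_real_sequentially]) auto
    then have "filterlim (\<lambda>k. s (r k)) at_top sequentially"
      using lr(1) filterlim_compose filterlim_subseq by blast
    then have "omega_limit_point \<phi> l"
      unfolding omega_limit_point_def using s0 lr(2) by (intro exI[of _ "s \<circ> r"]) (auto simp: o_def)
    then show ?thesis
      using lim lr by (auto simp: o_def)
  qed
  from sub[of real] have ne: "S \<noteq> {}"
    by auto
  have "((\<lambda>t. infdist (\<phi> t) S) \<longlongrightarrow> 0) at_top"
  proof (rule ccontr)
    assume "\<not> ((\<lambda>t. infdist (\<phi> t) S) \<longlongrightarrow> 0) at_top"
    then obtain e where e: "e > 0" "\<And>N. \<exists>t\<ge>N. infdist (\<phi> t) S \<ge> e"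
      unfolding tendsto_iff eventually_at_top_linorder
      by (auto simp: infdist_nonneg not_less)
    obtain s where s: "\<And>k. s k \<ge> real k" "\<And>k. infdist (\<phi> (s k)) S \<ge> e"
      using e(2)[of "real _"] by metis
    from sub[of s, OF s(1)] obtain l r where lr: "l \<in> S" "(\<lambda>k. \<phi> (s (r k))) \<longlonglongrightarrow> l"
      by blast
    have "(\<lambda>k. infdist (\<phi> (s (r k))) S) \<longlonglongrightarrow> infdist l S"
      by (intro tendsto_infdist lr)
    then have "e \<le> infdist l S"
      using s(2) by (intro LIMSEQ_le_const) auto
    then show False
      using lr e by simp
  qed
  with ne show ?thesis
    by (simp add: converges_to_set_def)
qed

section \<open>The Gram matrix along a trajectory\<close>

lemma landing_solution_gram_derivative:
  fixes \<phi> :: "real \<Rightarrow> real ^ 'p ^ 'n"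
  defines "G \<equiv> \<lambda>t. transpose (\<phi> t) ** \<phi> t"
  assumes "landing_solution lam f X\<^sub>0 \<phi>" "t \<ge> 0"
  shows "(G has_vector_derivative - ((2 * lam) *\<^sub>R (G t ** (G t - mat 1)))) (at t within {0..})"
proof -
  have d: "(\<phi> has_vector_derivative - landing_field lam f (\<phi> t)) (at t within {0..})"
    using assms by (simp add: landing_solution_def)
  have "(G has_vector_derivative (transpose (\<phi> t) ** - landing_field lam f (\<phi> t) +
      transpose (- landing_field lam f (\<phi> t)) ** \<phi> t)) (at t within {0..})"
    unfolding G_def
    by (rule bounded_bilinear.has_vector_derivative[OF bounded_bilinear_matrix_mult
          bounded_linear.has_vector_derivative[OF bounded_linear_transpose d] d])
  moreover have "transpose (\<phi> t) ** - landing_field lam f (\<phi> t) +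
      transpose (- landing_field lam f (\<phi> t)) ** \<phi> t = - ((2 * lam) *\<^sub>R (G t ** (G t - mat 1)))"
    unfolding G_def landing_field_gram[of "\<phi> t" lam f, symmetric] transpose_minus matrix_mult_minus
    by simp
  ultimately show ?thesis
    by simp
qed

text \<open>The quadratic form of the Gram matrix at \<open>x\<close> is the squared norm of
  \<open>X *v x\<close>, so full column rank makes its kernel trivial.\<close>

lemma gram_invertible:
  fixes X :: "real ^ 'p ^ 'n"
  assumes "rank X = CARD('p)"
  shows "\<exists>H. (transpose X ** X) ** H = mat 1"
proof -
  have "x = 0" if "(transpose X ** X) *v x = 0" for x
  proof -
    have "(X *v x) \<bullet> (X *v x) = x \<bullet> ((transpose X ** X) *v x)"
      by (metis dot_lmul_matrix inner_commute matrix_vector_mul_assoc vector_transpose_matrix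
          transpose_transpose)
    then have "X *v x = 0"
      using that by simp
    then show ?thesis
      using assms matrix_nonfull_linear_equations_eq by blast
  qed
  then show ?thesis
    using matrix_left_invertible_ker matrix_left_right_inverse by blast
qed

text \<open>The penalty is a Lyapunov function: the inner product of \<open>G - mat 1\<close> with
  its derivative is \<open>- 2 * lam\<close> times the squared norm of
  \<open>\<phi> t ** (G t - mat 1)\<close>.\<close>

lemma landing_solution_gram_bounded:
  fixes \<phi> :: "real \<Rightarrow> real ^ 'p ^ 'n"
  assumes sol: "landing_solution lam f X\<^sub>0 \<phi>" and lam: "lam > 0" and t: "t \<ge> 0"
  shows "norm (transpose (\<phi> t) ** \<phi> t - mat 1) \<le> norm (transpose X\<^sub>0 ** X\<^sub>0 - mat 1)"
proof -
  define G where "G t = transpose (\<phi> t) ** \<phi> t" for t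
  have "((\<lambda>t. G t - mat 1) has_vector_derivative - ((2 * lam) *\<^sub>R (G t ** (G t - mat 1))))
      (at t within {0..})" if "t \<ge> 0" for t
    using landing_solution_gram_derivative[OF sol that] unfolding G_def
    by (auto intro!: derivative_eq_intros)
  moreover have "(G t - mat 1) \<bullet> - ((2 * lam) *\<^sub>R (G t ** (G t - mat 1))) \<le> 0" for t
    using lam by (simp add: G_def inner_gram_mult)
  ultimately have "norm (G t - mat 1) \<le> norm (G 0 - mat 1)"
    by (rule norm_le_initial) (auto simp: t)
  then show ?thesis
    using sol by (simp add: G_def landing_solution_def)
qed

text \<open>Pairing the Gram matrix with the identity gives its trace, which is the squared norm of
  \<open>\<phi> t\<close>; Cauchy-Schwarz and the bound on \<open>G - I\<close> control it.\<close>

lemma landing_solution_bounded: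
  fixes \<phi> :: "real \<Rightarrow> real ^ 'p ^ 'n"
  assumes sol: "landing_solution lam f X\<^sub>0 \<phi>" and lam: "lam > 0"
  shows "bounded (\<phi> ` {0..})"
proof -
  define E where "E = norm (transpose X\<^sub>0 ** X\<^sub>0 - mat 1)"
  define I where "I = (mat 1 :: real ^ 'p ^ 'p)"
  have "norm (\<phi> t) \<le> sqrt (norm I * (E + norm I))" if "t \<ge> 0" for t
  proof -
    define G where "G = transpose (\<phi> t) ** \<phi> t"
    have "norm G \<le> norm (G - I) + norm I"
      using norm_triangle_ineq[of "G - I" I] by simp
    also have "norm (G - I) \<le> E"
      unfolding G_def E_def I_def by (rule landing_solution_gram_bounded[OF sol lam that])
    finally have "norm G \<le> E + norm I"
      by simp
    then have "I \<bullet> G \<le> norm I * (E + norm I)"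
      using norm_cauchy_schwarz[of I G] mult_left_mono[of "norm G" "E + norm I" "norm I"] by simp
    moreover have "(norm (\<phi> t))\<^sup>2 = I \<bullet> G"
      using inner_matrix_mult_left[of "\<phi> t" I "\<phi> t"]
      by (simp add: G_def I_def power2_norm_eq_inner)
    ultimately show ?thesis
      by (simp add: real_le_rsqrt)
  qed
  then show ?thesis
    unfolding bounded_iff by auto
qed

text \<open>
  With \<open>D = G K - I\<close>, the equations for \<open>G\<close> and \<open>K\<close> give the linear equation \<open>D' = -2\<lambda> G D\<close>
  with \<open>D(0) = 0\<close>, and \<open>\<parallel>D\<parallel>\<close> cannot grow because \<open>G\<close> is positive semidefinite.
\<close>

lemma landing_solution_gram_explicit:
  fixes \<phi> :: "real \<Rightarrow> real ^ 'p ^ 'n"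
  assumes sol: "landing_solution lam f X\<^sub>0 \<phi>" and lam: "lam > 0"
    and H: "(transpose X\<^sub>0 ** X\<^sub>0) ** H = mat 1" and t: "t \<ge> 0"
  shows "transpose (\<phi> t) ** \<phi> t - mat 1 =
    - (exp (- 2 * lam * t) *\<^sub>R ((transpose (\<phi> t) ** \<phi> t) ** (H - mat 1)))"
proof -
  define G where "G t = transpose (\<phi> t) ** \<phi> t" for t
  \<comment> \<open>\<open>K\<close> is the candidate for the inverse of \<open>G\<close>: passing
    to the inverse turns the quadratic equation for \<open>G\<close> into the linear equation
    \<open>K' = - 2 * lam * (K - mat 1)\<close> with \<open>K 0 = H\<close>.\<close>
  define K where "K t = mat 1 + exp (- 2 * lam * t) *\<^sub>R (H - mat 1)" for t
  define D where "D t = G t ** K t - mat 1" for t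
  have "(D has_vector_derivative - ((2 * lam) *\<^sub>R (G t ** D t))) (at t within {0..})"
    if "t \<ge> 0" for t
  proof -
    have G': "(G has_vector_derivative - ((2 * lam) *\<^sub>R (G t ** (G t - mat 1)))) (at t within {0..})"
      using landing_solution_gram_derivative[OF sol that] by (simp add: G_def[abs_def])
    have "((\<lambda>t. exp (- 2 * lam * t)) has_real_derivative - (2 * lam) * exp (- 2 * lam * t))
        (at t within {0..})"
      by (auto intro!: derivative_eq_intros)
    then have K': "(K has_vector_derivative - ((2 * lam) *\<^sub>R (K t - mat 1))) (at t within {0..})"
      unfolding K_def by (auto intro!: derivative_eq_intros)
    have "(D has_vector_derivative (G t ** - ((2 * lam) *\<^sub>R (K t - mat 1)) +
        - ((2 * lam) *\<^sub>R (G t ** (G t - mat 1))) ** K t)) (at t within {0..})"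
      unfolding D_def
      using bounded_bilinear.has_vector_derivative[OF bounded_bilinear_matrix_mult G' K']
      by (auto intro!: derivative_eq_intros)
    moreover have "G t ** - ((2 * lam) *\<^sub>R (K t - mat 1)) +
        - ((2 * lam) *\<^sub>R (G t ** (G t - mat 1))) ** K t = - ((2 * lam) *\<^sub>R (G t ** D t))"
      by (simp add: D_def matrix_mult_minus matrix_mult_scaleR matrix_mult_diff_distrib
          matrix_mul_assoc scaleR_diff_right)
    ultimately show ?thesis
      by simp
  qed
  moreover have "D t \<bullet> - ((2 * lam) *\<^sub>R (G t ** D t)) \<le> 0" for t
    using lam by (simp add: G_def inner_gram_mult)
  ultimately have "norm (D t) \<le> norm (D 0)"
    by (rule norm_le_initial) (auto simp: t)
  moreover have "D 0 = 0"
    using sol H by (simp add: D_def K_def G_def landing_solution_def)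
  ultimately have "G t ** K t = mat 1"
    by (simp add: D_def)
  then have "G t + exp (- 2 * lam * t) *\<^sub>R (G t ** (H - mat 1)) = mat 1"
    by (simp add: K_def matrix_mult_add_distrib matrix_mult_scaleR)
  then have "G t - mat 1 = - (exp (- 2 * lam * t) *\<^sub>R (G t ** (H - mat 1)))"
    by (metis add_diff_cancel_left' diff_add_cancel minus_diff_eq)
  then show ?thesis
    by (simp only: G_def)
qed

section \<open>Limits of the Gram matrix and of \<open>landing_psi\<close> along a
  trajectory\<close>

lemma inner_landing_field_gradient:
  fixes X :: "real ^ 'p ^ 'n"
  shows "landing_field lam f X \<bullet> gradient f X = (norm (landing_psi f X))\<^sup>2 / 2 +
    lam * ((X ** (transpose X ** X - mat 1)) \<bullet> gradient f X)"
  by (simp add: landing_field_eq inner_add_left inner_landing_psi_gradient)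

lemma bounded_on_trajectory:
  fixes g :: "'a::heine_borel \<Rightarrow> 'b::real_normed_vector"
  assumes "bounded (\<phi> ` {0..})" "continuous_on UNIV g"
  obtains B where "\<And>t::real. t \<ge> 0 \<Longrightarrow> norm (g (\<phi> t)) \<le> B"
proof -
  have "compact (closure (\<phi> ` {0..}))"
    using assms(1) by (simp add: compact_closure)
  then have "bounded (g ` closure (\<phi> ` {0..}))"
    by (intro compact_imp_bounded compact_continuous_image continuous_on_subset[OF assms(2)]) auto
  then obtain B where "\<forall>y\<in>g ` closure (\<phi> ` {0..}). norm y \<le> B"
    by (auto simp: bounded_iff)
  then have "norm (g (\<phi> t)) \<le> B" if "t \<ge> 0" for t
    using that closure_subset[of "\<phi> ` {0..}"] by blast
  then show ?thesis
    by (rule that)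
qed

lemma continuous_on_landing_psi:
  assumes "continuous_on UNIV (gradient f)"
  shows "continuous_on UNIV (landing_psi f)"
  unfolding landing_psi_def[abs_def] skew_def by (intro continuous_intros assms)

lemma continuous_on_landing_field:
  assumes "continuous_on UNIV (gradient f)"
  shows "continuous_on UNIV (landing_field lam f)"
  unfolding landing_field_eq[abs_def] by (intro continuous_intros continuous_on_landing_psi assms)

text \<open>In the explicit formula the factor of the decaying exponential is a continuous function
  of \<open>\<phi> t\<close>, hence bounded on the trajectory.\<close>

lemma landing_solution_gram_tendsto:
  fixes \<phi> :: "real \<Rightarrow> real ^ 'p ^ 'n"
  assumes sol: "landing_solution lam f X\<^sub>0 \<phi>" and lam: "lam > 0" and "rank X\<^sub>0 = CARD('p)"
  shows "((\<lambda>t. transpose (\<phi> t) ** \<phi> t) \<longlongrightarrow> mat 1) at_top"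
proof -
  obtain H where H: "(transpose X\<^sub>0 ** X\<^sub>0) ** H = mat 1"
    using gram_invertible assms(3) by blast
  obtain B where B: "\<And>t. t \<ge> 0 \<Longrightarrow> norm ((transpose (\<phi> t) ** \<phi> t) ** (H - mat 1)) \<le> B"
    by (rule bounded_on_trajectory[OF landing_solution_bounded[OF sol lam],
          of "\<lambda>X. (transpose X ** X) ** (H - mat 1)"])
      (auto intro!: continuous_intros)
  have "((\<lambda>t. exp (- 2 * lam * t) * B) \<longlongrightarrow> 0) at_top"
    using lam by real_asymp
  moreover have "\<forall>\<^sub>F t in at_top. norm (transpose (\<phi> t) ** \<phi> t - mat 1) \<le> exp (- 2 * lam * t) * B"
    using eventually_ge_at_top[of 0]
    by eventually_elim
      (simp add: landing_solution_gram_explicit[OF sol lam H] B mult_left_mono)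
  ultimately have "((\<lambda>t. transpose (\<phi> t) ** \<phi> t - mat 1) \<longlongrightarrow> 0) at_top"
    by (rule Lim_null_comparison[rotated])
  then show ?thesis
    by (simp add: LIM_zero_iff)
qed

text \<open>The field is bounded on the trajectory, so \<open>\<phi>\<close> is Lipschitz; the
  function composed with it is uniformly continuous on the compact closure of the
  trajectory.\<close>

lemma landing_solution_psi_uniformly_continuous:
  fixes \<phi> :: "real \<Rightarrow> real ^ 'p ^ 'n"
  assumes sol: "landing_solution lam f X\<^sub>0 \<phi>" and lam: "lam > 0"
    and cont: "continuous_on UNIV (gradient f)"
  shows "uniformly_continuous_on {0..} (\<lambda>t. (norm (landing_psi f (\<phi> t)))\<^sup>2 / 2)"
proof -
  have bdd: "bounded (\<phi> ` {0..})"
    by (rule landing_solution_bounded[OF sol lam])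
  obtain B where B: "\<And>t. t \<ge> 0 \<Longrightarrow> norm (landing_field lam f (\<phi> t)) \<le> B"
    using bounded_on_trajectory[OF bdd continuous_on_landing_field[OF cont, of lam]] by blast
  have "B-lipschitz_on {0..} \<phi>"
  proof (rule bounded_derivative_imp_lipschitz)
    show "(\<phi> has_derivative (\<lambda>h. h *\<^sub>R - landing_field lam f (\<phi> t))) (at t within {0..})"
      if "t \<in> {0..}" for t
      using sol that by (auto simp: landing_solution_def has_vector_derivative_def)
    show "onorm (\<lambda>h. h *\<^sub>R - landing_field lam f (\<phi> t)) \<le> B" if "t \<in> {0..}" for t
      using B[of t] that by (intro onorm_le) (auto simp: mult_left_mono mult.commute[of B])
    show "0 \<le> B"
      using B[of 0] by (meson norm_ge_zero order_refl order_trans)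
  qed auto
  then have "uniformly_continuous_on {0..} \<phi>"
    by (rule lipschitz_on_uniformly_continuous)
  moreover have "uniformly_continuous_on (closure (\<phi> ` {0..})) (\<lambda>X. (norm (landing_psi f X))\<^sup>2 / 2)"
    using bdd
    by (intro compact_uniformly_continuous continuous_intros
        continuous_on_subset[OF continuous_on_landing_psi[OF cont]]) (auto simp: compact_closure)
  then have "uniformly_continuous_on (\<phi> ` {0..}) (\<lambda>X. (norm (landing_psi f X))\<^sup>2 / 2)"
    unfolding uniformly_continuous_on_def by (meson closure_subset subsetD)
  ultimately show ?thesis
    by (rule uniformly_continuous_on_compose)
qed

lemma landing_solution_psi_tendsto:
  fixes \<phi> :: "real \<Rightarrow> real ^ 'p ^ 'n"
  assumes sol: "landing_solution lam f X\<^sub>0 \<phi>" and lam: "lam > 0" and rk: "rank X\<^sub>0 = CARD('p)"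
    and diff: "\<forall>X. f differentiable (at X)" and cont: "continuous_on UNIV (gradient f)"
  shows "((\<lambda>t. landing_psi f (\<phi> t)) \<longlongrightarrow> 0) at_top"
proof -
  obtain H where H: "(transpose X\<^sub>0 ** X\<^sub>0) ** H = mat 1"
    using gram_invertible rk by blast
  have bdd: "bounded (\<phi> ` {0..})"
    by (rule landing_solution_bounded[OF sol lam])
  define P where "P t = (norm (landing_psi f (\<phi> t)))\<^sup>2 / 2" for t
  \<comment> \<open>By the explicit Gram formula, the penalty part of the derivative of
    \<open>f\<close> along the trajectory is
    \<open>lam * exp (- 2 * lam * t) * R (\<phi> t)\<close>. It has no definite sign, but
    \<open>C\<close> bounds it uniformly.\<close>
  define R where "R X = (X ** (transpose X ** X ** (H - mat 1))) \<bullet> gradient f X" for X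
  have "continuous_on UNIV R"
    unfolding R_def by (intro continuous_intros cont)
  then obtain C where C: "\<And>t. t \<ge> 0 \<Longrightarrow> norm (R (\<phi> t)) \<le> C"
    using bounded_on_trajectory[OF bdd] by blast
  have C0: "C \<ge> 0"
    using C[of 0] by (meson norm_ge_zero order_refl order_trans)
  have "continuous_on UNIV f"
    using diff by (meson differentiable_imp_continuous_on differentiable_on_def
        differentiable_at_withinI)
  then obtain M where M: "\<And>t. t \<ge> 0 \<Longrightarrow> norm (f (\<phi> t)) \<le> M"
    using bounded_on_trajectory[OF bdd] by blast
  \<comment> \<open>The added term has derivative \<open>- lam * C * exp (- 2 * lam * t)\<close>,
    just enough to absorb that error, so \<open>h\<close> decreases at rate at least
    \<open>P\<close>. It is nonnegative, so \<open>h\<close> inherits the lower bound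
    \<open>- M\<close> from \<open>f\<close>.\<close>
  define h where "h t = f (\<phi> t) + C / 2 * exp (- 2 * lam * t)" for t
  define h' where "h' t = - (landing_field lam f (\<phi> t) \<bullet> gradient f (\<phi> t))
      - lam * C * exp (- 2 * lam * t)" for t
  have "(P \<longlongrightarrow> 0) at_top"
  proof (rule Barbalat)
    fix t :: real assume t: "t \<ge> 0"
    have "(f has_derivative (\<lambda>h. h \<bullet> gradient f (\<phi> t))) (at (\<phi> t))"
      using GDERIV_gradient diff unfolding gderiv_def by blast
    moreover have "(\<phi> has_derivative (\<lambda>h. h *\<^sub>R - landing_field lam f (\<phi> t))) (at t within {0..})"
      using sol t by (simp add: landing_solution_def has_vector_derivative_def)
    ultimately have "((\<lambda>t. f (\<phi> t)) has_derivative
        (\<lambda>h. (h *\<^sub>R - landing_field lam f (\<phi> t)) \<bullet> gradient f (\<phi> t))) (at t within {0..})"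
      by (rule has_derivative_compose[rotated])
    then have "((\<lambda>t. f (\<phi> t)) has_real_derivative
        - (landing_field lam f (\<phi> t) \<bullet> gradient f (\<phi> t))) (at t within {0..})"
      unfolding has_field_derivative_def
      by (rule has_derivative_eq_rhs) (auto simp: fun_eq_iff)
    then show "(h has_real_derivative h' t) (at t within {0..})"
      unfolding h_def h'_def by (auto intro!: derivative_eq_intros)
    have "(\<phi> t ** (transpose (\<phi> t) ** \<phi> t - mat 1)) \<bullet> gradient f (\<phi> t) =
        - exp (- 2 * lam * t) * R (\<phi> t)"
      unfolding landing_solution_gram_explicit[OF sol lam H t] R_def
      by (simp add: matrix_mult_minus matrix_mult_scaleR)
    then have "h' t = - P t + lam * exp (- 2 * lam * t) * (R (\<phi> t) - C)"
      by (simp add: h'_def inner_landing_field_gradient P_def algebra_simps)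
    moreover have "lam * exp (- 2 * lam * t) * (R (\<phi> t) - C) \<le> 0"
      using C[OF t] lam by (intro mult_nonneg_nonpos) auto
    ultimately show "h' t \<le> - P t"
      by linarith
    show "P t \<ge> 0"
      by (simp add: P_def)
    show "- M \<le> h t"
      using M[OF t] C0 unfolding h_def by (smt (verit) exp_ge_zero mult_nonneg_nonneg real_norm_def
          divide_nonneg_nonneg)
  next
    show "uniformly_continuous_on {0..} P"
      unfolding P_def by (rule landing_solution_psi_uniformly_continuous[OF sol lam cont])
  qed
  \<comment> \<open>The square root of \<open>2 * P t\<close> is the norm of
    \<open>landing_psi f (\<phi> t)\<close>.\<close>
  then have "((\<lambda>t. sqrt (2 * P t)) \<longlongrightarrow> sqrt (2 * 0)) at_top"
    by (intro tendsto_intros)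
  then show ?thesis
    by (simp add: P_def tendsto_norm_zero_iff)
qed

theorem theorem7:
  fixes f :: "real ^ 'p ^ 'n \<Rightarrow> real"
    and lam :: real
    and X\<^sub>0 :: "real ^ 'p ^ 'n"
    and \<phi> :: "real \<Rightarrow> real ^ 'p ^ 'n"
  assumes "CARD('p) \<le> CARD('n)"
    and "lam > 0"
    and "\<forall>X. f differentiable (at X)"
    and "continuous_on UNIV (gradient f)"
    and "local_lipschitz (UNIV :: real set) UNIV (\<lambda>_. gradient f)"
    and "rank X\<^sub>0 = CARD('p)"
    and "landing_solution lam f X\<^sub>0 \<phi>"
  shows "(\<forall>X. omega_limit_point \<phi> X \<longrightarrow> X \<in> Stiefel_critical_points f) \<and>
         converges_to_set \<phi> (Stiefel_critical_points f)"
proof -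
  have omega: "X \<in> Stiefel_critical_points f" if om: "omega_limit_point \<phi> X" for X
  proof -
    obtain s where s: "filterlim s at_top sequentially" and lim: "(\<lambda>k. \<phi> (s k)) \<longlonglongrightarrow> X"
      using om by (auto simp: omega_limit_point_def)
    \<comment> \<open>A limit along all times is also the limit along the times \<open>s k\<close>,
      where continuity gives the value \<open>g X\<close>.\<close>
    have transfer: "g X = l" if "continuous_on UNIV g" "((\<lambda>t. g (\<phi> t)) \<longlongrightarrow> l) at_top"
      for g :: "real ^ 'p ^ 'n \<Rightarrow> 'b::t2_space" and l
    proof (rule LIMSEQ_unique)
      show "(\<lambda>k. g (\<phi> (s k))) \<longlonglongrightarrow> g X"
        using that(1) lim by (rule continuous_on_tendsto_compose) auto
      show "(\<lambda>k. g (\<phi> (s k))) \<longlonglongrightarrow> l"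
        using that(2) s by (rule filterlim_compose)
    qed
    have "transpose X ** X = mat 1"
      by (rule transfer[OF _ landing_solution_gram_tendsto[OF assms(7,2,6)]])
        (intro continuous_intros)
    \<comment> \<open>The matrix \<open>landing_psi f X\<close> itself vanishes, hence so does its
      product with \<open>X\<close> in the criticality condition.\<close>
    moreover have "landing_psi f X = 0"
      by (rule transfer[OF continuous_on_landing_psi[OF assms(4)]
            landing_solution_psi_tendsto[OF assms(7,2,6,3,4)]])
    ultimately show ?thesis
      by (simp add: Stiefel_critical_points_def Stiefel_def
          bounded_bilinear.zero_left[OF bounded_bilinear_matrix_mult])
  qed
  then show ?thesis
    using converges_to_setI[OF landing_solution_bounded[OF assms(7,2)]] by blast
qed

end
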